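(* Let $n,i,j$ be integers with $0<i<j\le n/2$ and $\gcd(n,i,j)=1$, such that either $i=1$ or neither $i$ nor $j$ is a unit in $\mathbb{Z}_n$. Assume $C_n(i,j)$ has twins. (1) If $n\in\{4,5\}$, then $\operatorname{Det}(C_n(i,j))=n-1$ and $\operatorname{Dist}(C_n(i,j))=n$. (2) If $(n,i,j)=(6,1,3)$, then $\operatorname{Det}(C_n(i,j))=\operatorname{Dist}(C_n(i,j))=4$. (3) If $n\ge 6$ and $i+j=n/2$, then: if $(n,i,j)=(8,1,3)$, $\operatorname{Det}(C_8(1,3))=6$ and $\operatorname{Dist}(C_8(1,3))=5$; for all other values, $\operatorname{Det}(C_n(i,j))=n/2$ and $\operatorname{Dist}(C_n(i,j))=3$.
   Context: $C_n(i,j)$ is the simple undirected graph with vertex set $\mathbb{Z}_n$ in which $a,b$ are adjacent iff $a-b\equiv\pm i$ or $a-b\equiv\pm j \pmod n$. Distinct vertices $v,w$ are twins if $N(v)=N(w)$ (nonadjacent twins) or $N[v]=N[w]$ (adjacent twins), where $N(v)$ is the open neighborhood and $N[v]=N(v)\cup\{v\}$; a graph has twins if some two distinct vertices are twins. A determining set of a graph $G$ is a vertex subset $W$ such that only the identity automorphism fixes every vertex of $W$; $\operatorname{Det}(G)$ is the minimum size of a determining set. A $d$-distinguishing coloring is an assignment of $d$ colors to the vertices such that only the identity automorphism preserves every color class setwise; $\operatorname{Dist}(G)$ is the minimum such $d$. *)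

theory Defs
  imports "HOL-Number_Theory.Residues" "HOL-Combinatorics.Permutations"
begin

record 'a ugraph =
  verts :: "'a set"
  edges :: "'a set set"

definition simple_graph :: "'a ugraph \<Rightarrow> bool" where
  "simple_graph G \<longleftrightarrow> (\<forall>e\<in>edges G. e \<subseteq> verts G \<and> card e = 2)"

definition adj :: "'a ugraph \<Rightarrow> 'a \<Rightarrow> 'a \<Rightarrow> bool" where
  "adj G a b \<longleftrightarrow> {a, b} \<in> edges G"

definition open_nbhd :: "'a ugraph \<Rightarrow> 'a \<Rightarrow> 'a set" where
  "open_nbhd G v = {u \<in> verts G. adj G u v}"

definition closed_nbhd :: "'a ugraph \<Rightarrow> 'a \<Rightarrow> 'a set" where
  "closed_nbhd G v = insert v (open_nbhd G v)"

definition twins :: "'a ugraph \<Rightarrow> 'a \<Rightarrow> 'a \<Rightarrow> bool" where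
  "twins G v w \<longleftrightarrow> v \<in> verts G \<and> w \<in> verts G \<and> v \<noteq> w \<and>
     (open_nbhd G v = open_nbhd G w \<or> closed_nbhd G v = closed_nbhd G w)"

definition has_twins :: "'a ugraph \<Rightarrow> bool" where
  "has_twins G \<longleftrightarrow> (\<exists>v w. twins G v w)"

(* Automorphisms are extended by the identity outside the vertex set,
   so that the identity automorphism is exactly id. *)
definition automorphism :: "'a ugraph \<Rightarrow> ('a \<Rightarrow> 'a) \<Rightarrow> bool" where
  "automorphism G f \<longleftrightarrow> f permutes verts G \<and>
     (\<forall>a\<in>verts G. \<forall>b\<in>verts G. adj G (f a) (f b) \<longleftrightarrow> adj G a b)"

definition determining_set :: "'a ugraph \<Rightarrow> 'a set \<Rightarrow> bool" where
  "determining_set G W \<longleftrightarrow> W \<subseteq> verts G \<and>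
     (\<forall>f. automorphism G f \<and> (\<forall>w\<in>W. f w = w) \<longrightarrow> f = id)"

definition Det :: "'a ugraph \<Rightarrow> nat" where
  "Det G = (LEAST k. \<exists>W. finite W \<and> determining_set G W \<and> card W = k)"

definition distinguishing_coloring :: "'a ugraph \<Rightarrow> nat \<Rightarrow> ('a \<Rightarrow> nat) \<Rightarrow> bool" where
  "distinguishing_coloring G d c \<longleftrightarrow> c \<in> verts G \<rightarrow> {..<d} \<and>
     (\<forall>f. automorphism G f \<and>
          (\<forall>k<d. f ` {v \<in> verts G. c v = k} = {v \<in> verts G. c v = k}) \<longrightarrow> f = id)"

definition Dist :: "'a ugraph \<Rightarrow> nat" where
  "Dist G = (LEAST d. \<exists>c. distinguishing_coloring G d c)"

(* The vertex set is the set {0..n - 1} of representatives of the residue classes.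
   The condition a \<noteq> b is implied by the congruences unless i or j vanishes modulo n. *)
definition circulant :: "int \<Rightarrow> int \<Rightarrow> int \<Rightarrow> int ugraph" where
  "circulant n i j =
     \<lparr> verts = carrier (residue_ring n),
       edges = {{a, b} | a b.
         a \<in> carrier (residue_ring n) \<and> b \<in> carrier (residue_ring n) \<and> a \<noteq> b \<and>
         ([a - b = i] (mod n) \<or> [a - b = - i] (mod n) \<or>
          [a - b = j] (mod n) \<or> [a - b = - j] (mod n))} \<rparr>"

lemma verts_circulant: "verts (circulant n i j) = {0..n - 1}"
  by (simp add: circulant_def residue_ring_def)

lemma simple_graph_circulant: "simple_graph (circulant n i j)"
  by (auto simp: simple_graph_def circulant_def)

lemma cong_diff_swap: "[a - b = c] (mod n) \<longleftrightarrow> [b - a = - c] (mod n)" for a b c n :: int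
  using cong_minus_minus_iff[of "a - b" c n] by simp

lemma adj_circulant_iff:
  assumes "a \<in> verts (circulant n i j)" "b \<in> verts (circulant n i j)"
  shows "adj (circulant n i j) a b \<longleftrightarrow> a \<noteq> b \<and>
    ([a - b = i] (mod n) \<or> [a - b = - i] (mod n) \<or>
     [a - b = j] (mod n) \<or> [a - b = - j] (mod n))"
  using assms cong_diff_swap[of a b i n] cong_diff_swap[of a b "- i" n]
    cong_diff_swap[of a b j n] cong_diff_swap[of a b "- j" n]
  by (auto simp: adj_def circulant_def doubleton_eq_iff)

(* For finite vertex sets the minima in Det and Dist are attained. *)

lemma determining_set_verts: "determining_set G (verts G)"
  by (auto simp: determining_set_def automorphism_def permutes_def fun_eq_iff)

lemma ex_distinguishing_coloring:
  assumes "finite (verts G)"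
  shows "\<exists>c. distinguishing_coloring G (card (verts G)) c"
proof -
  obtain c where c: "bij_betw c (verts G) {..<card (verts G)}"
    using ex_bij_betw_finite_nat[OF assms] by (auto simp: atLeast0LessThan)
  have "f = id" if f: "automorphism G f"
    and cl: "\<forall>k<card (verts G). f ` {v \<in> verts G. c v = k} = {v \<in> verts G. c v = k}" for f
  proof
    fix x
    show "f x = id x"
    proof (cases "x \<in> verts G")
      case True
      then have "c x < card (verts G)" using c by (auto simp: bij_betw_def)
      with cl True have "f x \<in> verts G" "c (f x) = c x" by blast+
      with True c show ?thesis by (auto simp: bij_betw_def inj_on_def)
    next
      case False
      with f show ?thesis by (simp add: automorphism_def permutes_def)
    qed
  qed
  moreover have "c \<in> verts G \<rightarrow> {..<card (verts G)}"
    using c by (auto simp: bij_betw_def)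
  ultimately have "distinguishing_coloring G (card (verts G)) c"
    by (auto simp: distinguishing_coloring_def)
  then show ?thesis by blast
qed

end

theory Submission
  imports Defs
begin

text \<open>
  Two twins can be exchanged while every other vertex stays where it is. Hence a determining set
  misses at most one vertex of any set of pairwise twins, and a distinguishing colouring gives twins
  different colours (\<open>card_determining_set_twin_class\<close>, \<open>distinguishing_coloring_twins\<close>).
  The lower bounds for Det come from this alone, and the lower bounds for Dist almost do. The rest
  is to understand which automorphisms survive once the vertices inside each twin class have been
  told apart. This depends on how the classes sit in the graph, and there are three possibilities.

  The graphs \<open>C\<^sub>4(1,2)\<close> and \<open>C\<^sub>5(1,2)\<close> are complete, so all vertices form one
  twin class.

  In \<open>C\<^sub>6(1,3)\<close> and \<open>C\<^sub>8(1,3)\<close> two vertices are adjacent exactly when their difference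
  is odd, so these graphs are \<open>K\<^sub>3\<^sub>,\<^sub>3\<close> and \<open>K\<^sub>4\<^sub>,\<^sub>4\<close> and the twin classes are the
  two sides. Fixing one vertex already prevents an exchange of the sides. A colouring with only as
  many colours as a side has vertices would use all of them on both sides, and then matching equal
  colours would exchange the sides; one further colour breaks this symmetry.

  In the remaining case put \<open>m = i + j = n/2\<close>. Since \<open>j\<close> is congruent to \<open>- i\<close> modulo \<open>m\<close>, a
  vertex is adjacent to another one exactly when their difference is \<open>\<plusminus> i\<close> modulo \<open>m\<close>
  (\<open>circulant_doubled_cycle\<close>), and \<open>i\<close> is a unit modulo \<open>m\<close> by the gcd condition. The graph is
  therefore the cycle 0, \<open>i\<close>, \<open>2i\<close>, ... of length \<open>m\<close> in which each vertex \<open>r\<close> has been doubled to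
  the twins \<open>r\<close> and \<open>r + m\<close>. There are no further coincidences of neighbourhoods unless \<open>m\<close>
  divides \<open>4i\<close>, that is \<open>m = 4\<close>, which is the exceptional graph \<open>C\<^sub>8(1,3)\<close>. So automorphisms
  permute the \<open>m\<close> pairs, and one vertex from each pair determines them. Two colours do not suffice:
  every pair would use both, and the rotation of the cycle lifts to a colour preserving automorphism.
  Three colours provide three different palettes for the pairs, and palettes that mark two
  consecutive pairs of the cycle rule out its rotations and reflections.
\<close>

section \<open>Automorphisms, twins and colourings\<close>

lemma adj_commute: "adj G a b \<longleftrightarrow> adj G b a"
  by (simp add: adj_def insert_commute)

lemma simple_graph_not_adj_self: "simple_graph G \<Longrightarrow> \<not> adj G a a"
  by (auto simp: simple_graph_def adj_def)

lemma automorphism_in_verts: "automorphism G f \<Longrightarrow> f x \<in> verts G \<longleftrightarrow> x \<in> verts G"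
  by (simp add: automorphism_def permutes_in_image)

lemma automorphism_eqI:
  assumes "automorphism G f" "\<And>x. x \<in> verts G \<Longrightarrow> f x = x"
  shows "f = id"
proof
  fix x
  show "f x = id x"
    using assms by (cases "x \<in> verts G") (auto simp: automorphism_def permutes_def)
qed

text \<open>Automorphisms carry classes of nonadjacent twins to such classes; in a doubled cycle this
  makes them act on the underlying cycle.\<close>

lemma automorphism_same_open_nbhd_iff:
  assumes "automorphism G f" "x \<in> verts G" "y \<in> verts G"
  shows "open_nbhd G (f x) = open_nbhd G (f y) \<longleftrightarrow> open_nbhd G x = open_nbhd G y"
proof -
  have f: "f permutes verts G"
    and adj: "\<And>a b. a \<in> verts G \<Longrightarrow> b \<in> verts G \<Longrightarrow> adj G (f a) (f b) \<longleftrightarrow> adj G a b"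
    using assms(1) by (auto simp: automorphism_def)
  have "open_nbhd G (f x) = open_nbhd G (f y) \<longleftrightarrow>
      (\<forall>z \<in> f ` verts G. adj G z (f x) \<longleftrightarrow> adj G z (f y))"
    unfolding permutes_image[OF f] by (auto simp: open_nbhd_def)
  also have "\<dots> \<longleftrightarrow> (\<forall>z \<in> verts G. adj G z x \<longleftrightarrow> adj G z y)"
    using adj assms by auto
  also have "\<dots> \<longleftrightarrow> open_nbhd G x = open_nbhd G y"
    by (auto simp: open_nbhd_def)
  finally show ?thesis .
qed

lemma twins_adj_iff:
  assumes "twins G v w" "z \<in> verts G" "z \<noteq> v" "z \<noteq> w"
  shows "adj G z v \<longleftrightarrow> adj G z w"
  using assms by (auto simp: twins_def open_nbhd_def closed_nbhd_def)

text \<open>A third vertex does not distinguish the twins, and the possible edge between them is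
  preserved because adjacency is symmetric.\<close>

lemma automorphism_transpose_twins:
  assumes "simple_graph G" "twins G v w"
  shows "automorphism G (transpose v w)"
proof -
  have vw: "v \<in> verts G" "w \<in> verts G" "v \<noteq> w"
    using assms(2) by (auto simp: twins_def)
  have outside: "adj G z (transpose v w b) \<longleftrightarrow> adj G z b"
    if "z \<in> verts G" "z \<noteq> v" "z \<noteq> w" for z b
    using twins_adj_iff[OF assms(2) that] by (simp add: transpose_def)
  have "adj G (transpose v w a) (transpose v w b) \<longleftrightarrow> adj G a b"
    if ab: "a \<in> verts G" "b \<in> verts G" for a b
  proof -
    consider "a \<noteq> v" "a \<noteq> w" | "b \<noteq> v" "b \<noteq> w" | "a \<in> {v, w}" "b \<in> {v, w}" "a \<noteq> b" | "a = b"
      by blast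
    then show ?thesis
    proof cases
      case 1
      then show ?thesis using outside[OF ab(1)] by simp
    next
      case 2
      then have "transpose v w b = b" by simp
      then show ?thesis
        using outside[OF ab(2) 2, of a] adj_commute[of G b] by simp
    next
      case 3
      then have "transpose v w a = b" "transpose v w b = a" by auto
      then show ?thesis using adj_commute[of G a b] by simp
    next
      case 4
      then show ?thesis using simple_graph_not_adj_self[OF assms(1)] by simp
    qed
  qed
  then show ?thesis
    using vw by (simp add: automorphism_def permutes_swap_id)
qed

lemma determining_set_twins:
  assumes "simple_graph G" "determining_set G W" "twins G v w"
  shows "v \<in> W \<or> w \<in> W"
proof (rule ccontr)
  assume "\<not> ?thesis"
  then have "\<forall>x\<in>W. transpose v w x = x"
    by (auto simp: transpose_def)
  then have "transpose v w = id"
    using assms automorphism_transpose_twins[OF assms(1,3)] by (auto simp: determining_set_def)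
  then have "transpose v w v = v" by simp
  then show False using assms(3) by (auto simp: twins_def)
qed

text \<open>Two missed vertices of \<open>P\<close> would be twins outside \<open>W\<close>.\<close>

lemma card_determining_set_twin_class:
  assumes "simple_graph G" "determining_set G W" "finite P"
    and tw: "\<And>v w. v \<in> P \<Longrightarrow> w \<in> P \<Longrightarrow> v \<noteq> w \<Longrightarrow> twins G v w"
  shows "card P - 1 \<le> card (W \<inter> P)"
proof -
  have "card (P - W) \<le> 1"
    using determining_set_twins[OF assms(1,2)] tw assms(3)
    by (auto simp: card_le_Suc0_iff_eq)
  moreover have "card P = card (W \<inter> P) + card (P - W)"
    using assms(3) by (metis Int_commute card_Int_Diff)
  ultimately show ?thesis by simp
qed

text \<open>As an automorphism maps the vertex set onto itself, preserving all colour classes setwise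
  is the same as preserving the colour of each vertex, which is easier to use.\<close>

lemma distinguishing_coloring_iff:
  "distinguishing_coloring G d c \<longleftrightarrow> c \<in> verts G \<rightarrow> {..<d} \<and>
     (\<forall>f. automorphism G f \<and> (\<forall>v\<in>verts G. c (f v) = c v) \<longrightarrow> f = id)"
proof -
  have "(\<forall>k<d. f ` {v \<in> verts G. c v = k} = {v \<in> verts G. c v = k}) \<longleftrightarrow>
      (\<forall>v\<in>verts G. c (f v) = c v)"
    if c: "c \<in> verts G \<rightarrow> {..<d}" and f: "automorphism G f" for f
  proof
    assume "\<forall>k<d. f ` {v \<in> verts G. c v = k} = {v \<in> verts G. c v = k}"
    then show "\<forall>v\<in>verts G. c (f v) = c v"
      using c by blast
  next
    assume fix_c: "\<forall>v\<in>verts G. c (f v) = c v"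
    have "f ` verts G = verts G"
      using f by (auto simp: automorphism_def permutes_image)
    then show "\<forall>k<d. f ` {v \<in> verts G. c v = k} = {v \<in> verts G. c v = k}"
      using fix_c by (auto simp: set_eq_iff image_iff) (metis+)
  qed
  then show ?thesis
    unfolding distinguishing_coloring_def by blast
qed

lemma distinguishing_coloring_twins:
  assumes "simple_graph G" "distinguishing_coloring G d c" "twins G v w"
  shows "c v \<noteq> c w"
proof
  assume "c v = c w"
  then have "\<forall>x\<in>verts G. c (transpose v w x) = c x"
    by (auto simp: transpose_def)
  then have "transpose v w = id"
    using assms automorphism_transpose_twins[OF assms(1,3)]
    by (auto simp: distinguishing_coloring_iff)
  then have "transpose v w v = v" by simp
  then show False using assms(3) by (auto simp: twins_def)
qed

lemma Det_eqI:
  assumes "finite W" "determining_set G W" "card W = k"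
    and "\<And>W. finite W \<Longrightarrow> determining_set G W \<Longrightarrow> k \<le> card W"
  shows "Det G = k"
  unfolding Det_def using assms by (intro Least_equality) auto

lemma Dist_eqI:
  assumes "distinguishing_coloring G d c"
    and "\<And>d' c. distinguishing_coloring G d' c \<Longrightarrow> d \<le> d'"
  shows "Dist G = d"
  unfolding Dist_def using assms by (intro Least_equality) auto

section \<open>Complete graphs\<close>

text \<open>All vertices are adjacent twins of each other, so at most one vertex is missed by a
  determining set and all colours are different. Conversely, an automorphism that fixes all vertices
  but one has nowhere to move the last one.\<close>

lemma Det_Dist_complete:
  assumes simple: "simple_graph G" and fin: "finite (verts G)" and ne: "verts G \<noteq> {}"
    and complete: "\<And>a b. a \<in> verts G \<Longrightarrow> b \<in> verts G \<Longrightarrow> a \<noteq> b \<Longrightarrow> adj G a b"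
  shows "Det G = card (verts G) - 1" and "Dist G = card (verts G)"
proof -
  have tw: "twins G v w" if "v \<in> verts G" "w \<in> verts G" "v \<noteq> w" for v w
    using that complete by (auto simp: twins_def closed_nbhd_def open_nbhd_def)
  show "Det G = card (verts G) - 1"
  proof -
    obtain a where a: "a \<in> verts G" using ne by blast
    have "f = id" if f: "automorphism G f" and fx: "\<forall>w \<in> verts G - {a}. f w = w" for f
    proof (rule automorphism_eqI[OF f])
      fix x assume x: "x \<in> verts G"
      have "inj f" using f by (auto simp: automorphism_def permutes_inj)
      moreover have "f a \<in> verts G" using f a by (simp add: automorphism_in_verts)
      ultimately have "f a = a" using fx by (metis Diff_iff injD singletonD)
      then show "f x = x" using fx x by blast
    qed
    then have "determining_set G (verts G - {a})"
      by (auto simp: determining_set_def)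
    then show ?thesis
    proof (rule Det_eqI[rotated])
      fix W assume W: "finite W" "determining_set G W"
      have "card (verts G) - 1 \<le> card (W \<inter> verts G)"
        using card_determining_set_twin_class[OF simple W(2) fin] tw by blast
      also have "\<dots> \<le> card W" using W by (simp add: card_mono)
      finally show "card (verts G) - 1 \<le> card W" .
    qed (use fin a in auto)
  qed
  show "Dist G = card (verts G)"
  proof -
    obtain c where "distinguishing_coloring G (card (verts G)) c"
      using ex_distinguishing_coloring[OF fin] by blast
    then show ?thesis
    proof (rule Dist_eqI)
      fix d c assume c: "distinguishing_coloring G d c"
      then have "inj_on c (verts G)"
        using distinguishing_coloring_twins[OF simple c] tw by (metis inj_onI)
      then show "card (verts G) \<le> d"
        using c card_inj_on_le[of c "verts G" "{..<d}"] by (auto simp: distinguishing_coloring_def)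
    qed
  qed
qed

section \<open>Balanced complete bipartite graphs\<close>

locale balanced_complete_bipartite =
  fixes G :: "'a ugraph" and A B :: "'a set" and p :: nat
  assumes simple: "simple_graph G"
    and verts: "verts G = A \<union> B" and disj: "A \<inter> B = {}"
    and fin: "finite A" "finite B" and card_A: "card A = p" and card_B: "card B = p"
    and p: "2 \<le> p"
    and adj_iff: "\<And>a b. a \<in> A \<union> B \<Longrightarrow> b \<in> A \<union> B \<Longrightarrow> adj G a b \<longleftrightarrow> (a \<in> A) \<noteq> (b \<in> A)"
begin

lemma twins_same_part:
  assumes "v \<in> A \<union> B" "w \<in> A \<union> B" "v \<in> A \<longleftrightarrow> w \<in> A" "v \<noteq> w"
  shows "twins G v w"
  using assms adj_iff by (auto simp: twins_def open_nbhd_def verts)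

text \<open>The side of a vertex can be read off from its adjacency to the fixed vertex \<open>a\<close>, so a
  single fixed vertex prevents an exchange of the sides.\<close>

lemma automorphism_same_part:
  assumes "automorphism G f" "f a = a" "a \<in> A \<union> B" "x \<in> A \<union> B"
  shows "f x \<in> A \<longleftrightarrow> x \<in> A"
proof -
  have "f x \<in> A \<union> B" using assms by (metis automorphism_in_verts verts)
  then have "((f x \<in> A) \<noteq> (a \<in> A)) \<longleftrightarrow> adj G (f x) (f a)"
    using assms adj_iff by simp
  also have "\<dots> \<longleftrightarrow> adj G x a"
    using assms unfolding automorphism_def verts by blast
  also have "\<dots> \<longleftrightarrow> (x \<in> A) \<noteq> (a \<in> A)"
    using assms adj_iff by simp
  finally show ?thesis by auto
qed

text \<open>The sides are twin classes, so one vertex of each may be omitted, but no more.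
  Because \<open>p\<close> is at least 2, some vertex stays in the set and keeps the sides apart; for \<open>p = 1\<close>
  the two omitted vertices could be exchanged.\<close>

lemma Det: "Det G = 2 * (p - 1)"
proof -
  obtain a b where ab: "a \<in> A" "b \<in> B"
    using card_A card_B p by (metis card.empty ex_in_conv not_numeral_le_zero)
  have "A \<noteq> {a}" using card_A p by auto
  then obtain a' where a': "a' \<in> A" "a' \<noteq> a" using ab by blast
  define W where "W = (A - {a}) \<union> (B - {b})"
  have W: "finite W" using fin by (simp add: W_def)
  have cW: "card W = 2 * (p - 1)"
    unfolding W_def using fin disj ab card_A card_B
    by (subst card_Un_disjoint) auto
  have "f = id" if f: "automorphism G f" and fx: "\<forall>w \<in> W. f w = w" for f
  proof (rule automorphism_eqI[OF f])
    fix x assume x: "x \<in> verts G"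
    have inj: "inj f" using f by (auto simp: automorphism_def permutes_inj)
    have part: "f y \<in> A \<longleftrightarrow> y \<in> A" if "y \<in> A \<union> B" for y
      using automorphism_same_part[OF f, of a' y] that fx a' by (auto simp: W_def)
    have V: "f y \<in> A \<union> B \<longleftrightarrow> y \<in> A \<union> B" for y
      using f by (metis automorphism_in_verts verts)
    have "f a = a"
      using inj part[of a] fx ab unfolding W_def by (metis Diff_iff UnCI injD singletonD)
    moreover have "f b = b"
      using inj part[of b] V[of b] fx ab disj unfolding W_def
      by (metis Diff_iff UnCI UnE disjoint_iff injD singletonD)
    ultimately show "f x = x" using fx x by (auto simp: W_def verts)
  qed
  then have "determining_set G W"
    by (auto simp: determining_set_def verts W_def)
  then show ?thesis
  proof (rule Det_eqI[OF W _ cW])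
    fix W assume W: "finite W" "determining_set G W"
    have "card A - 1 \<le> card (W \<inter> A)"
      by (rule card_determining_set_twin_class[OF simple W(2)]) (auto simp: fin intro: twins_same_part)
    moreover have "card B - 1 \<le> card (W \<inter> B)"
      by (rule card_determining_set_twin_class[OF simple W(2)])
         (use disj in \<open>auto simp: fin intro!: twins_same_part\<close>)
    moreover have "card (W \<inter> A) + card (W \<inter> B) \<le> card W"
      using W disj by (subst card_Un_disjoint[symmetric]) (auto intro: card_mono)
    ultimately show "2 * (p - 1) \<le> card W" using card_A card_B by simp
  qed
qed

text \<open>Each side needs \<open>p\<close> colours. If these are 0, ..., \<open>p - 1\<close> on one side and 1, ..., \<open>p\<close> on
  the other, then the vertex of colour 0 is fixed by colour preserving automorphisms, and this keeps
  the sides apart. If both sides have the same \<open>p\<close> colours, then exchanging vertices of the same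
  colour is a nontrivial automorphism.\<close>

lemma Dist: "Dist G = p + 1"
proof -
  obtain g where g: "bij_betw g A {..<p}"
    using ex_bij_betw_finite_nat[OF fin(1)] card_A by (auto simp: atLeast0LessThan)
  obtain h where h: "bij_betw h B {..<p}"
    using ex_bij_betw_finite_nat[OF fin(2)] card_B by (auto simp: atLeast0LessThan)
  define c where "c x = (if x \<in> A then g x else Suc (h x))" for x
  have inj: "x = y" if "c x = c y" "x \<in> A \<union> B" "y \<in> A \<union> B" "x \<in> A \<longleftrightarrow> y \<in> A" for x y
    using that inj_onD[OF bij_betw_imp_inj_on[OF g]] inj_onD[OF bij_betw_imp_inj_on[OF h]]
    by (cases "x \<in> A") (simp_all add: c_def)
  have "0 \<in> g ` A" using g p by (simp add: bij_betw_def)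
  then obtain a where a: "a \<in> A" "g a = 0" by (metis imageE)
  have "f = id" if f: "automorphism G f" and fx: "\<forall>v\<in>verts G. c (f v) = c v" for f
  proof (rule automorphism_eqI[OF f])
    have V: "f y \<in> A \<union> B" if "y \<in> A \<union> B" for y
      using f that by (metis automorphism_in_verts verts)
    \<comment> \<open>Only vertices of \<open>A\<close> can have colour 0, so \<open>a\<close> is the only vertex of this colour.\<close>
    have "c (f a) = 0" using fx a by (simp add: verts c_def)
    then have "f a \<in> A" by (auto simp: c_def split: if_splits)
    then have "f a = a" using inj[of "f a" a] fx a by (simp add: verts)
    then show "f x = x" if "x \<in> verts G" for x
      using that inj[of "f x" x] fx V[of x] automorphism_same_part[OF f, of a x] a
      by (auto simp: verts)
  qed
  moreover have "c x < p + 1" if "x \<in> A \<union> B" for x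
    using that bij_betwE[OF g] bij_betwE[OF h] by (cases "x \<in> A") (auto simp: c_def intro: less_SucI)
  then have "c \<in> verts G \<rightarrow> {..<p + 1}"
    by (simp add: verts)
  ultimately have "distinguishing_coloring G (p + 1) c"
    by (auto simp: distinguishing_coloring_iff)
  then show ?thesis
  proof (rule Dist_eqI)
    fix d c assume c: "distinguishing_coloring G d c"
    have ne: "c v \<noteq> c w" if "v \<in> A \<union> B" "w \<in> A \<union> B" "v \<in> A \<longleftrightarrow> w \<in> A" "v \<noteq> w" for v w
      using distinguishing_coloring_twins[OF simple c] twins_same_part that by blast
    have injA: "inj_on c A" and injB: "inj_on c B"
      using ne disj by (auto simp: inj_on_def)
    have sub: "c ` A \<subseteq> {..<d}" "c ` B \<subseteq> {..<d}"
      using c by (auto simp: distinguishing_coloring_def verts)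
    show "p + 1 \<le> d"
    proof (rule ccontr)
      assume "\<not> p + 1 \<le> d"
      then have "d \<le> p" by simp
      have AB: "c ` A = {..<d}" "c ` B = {..<d}"
        using card_seteq[OF _ sub(1)] card_seteq[OF _ sub(2)] card_image[OF injA] card_image[OF injB]
          \<open>d \<le> p\<close> card_A card_B by simp_all
      define f where "f x = (if x \<in> A then inv_into B c (c x)
        else if x \<in> B then inv_into A c (c x) else x)" for x
      have fA: "f x \<in> B \<and> c (f x) = c x" if "x \<in> A" for x
        using that AB by (auto simp: f_def intro!: inv_into_into f_inv_into_f)
      have fB: "f x \<in> A \<and> c (f x) = c x" if "x \<in> B" for x
        using that AB disj by (auto simp: f_def intro!: inv_into_into f_inv_into_f)
      have ff: "f (f x) = x" for x
      proof -
        consider "x \<in> A" | "x \<in> B" | "x \<notin> A \<union> B" by blast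
        then show ?thesis
        proof cases
          case 1
          then show ?thesis using fA[of x] fB[of "f x"] injA by (auto simp: inj_on_def)
        next
          case 2
          then show ?thesis using fB[of x] fA[of "f x"] injB by (auto simp: inj_on_def)
        qed (simp add: f_def)
      qed
      have "f permutes verts G"
        unfolding permutes_def
      proof (intro conjI allI impI)
        show "\<exists>!y. f y = x" for x by (metis ff)
      qed (simp add: f_def verts)
      moreover have "f x \<in> A \<union> B" "f x \<in> A \<longleftrightarrow> x \<notin> A" if "x \<in> A \<union> B" for x
        using that fA[of x] fB[of x] disj by auto
      ultimately have "automorphism G f"
        unfolding automorphism_def verts by (simp add: adj_iff)
      then have "f = id"
        using c fA fB by (auto simp: distinguishing_coloring_iff verts)
      moreover obtain a where "a \<in> A" using a by blast
      ultimately show False using fA[of a] disj by auto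
    qed
  qed
qed

end

section \<open>Cycles with doubled vertices\<close>

text \<open>The condition on \<open>i\<close> makes 0, \<open>i\<close>, \<open>2i\<close>, ... run through all residues modulo \<open>m\<close>, so
  adjacent residues form one cycle of length \<open>m\<close>. Length 4 is excluded because opposite vertices of
  a 4-cycle have the same neighbours, which makes the twin classes larger.\<close>

locale doubled_cycle =
  fixes G :: "int ugraph" and m i :: int
  assumes simple: "simple_graph G"
    and verts: "verts G = {0..<2 * m}"
    and m: "3 \<le> m" "m \<noteq> 4" and coprime: "coprime i m"
    and adj_iff: "\<And>x y. x \<in> verts G \<Longrightarrow> y \<in> verts G \<Longrightarrow>
      adj G x y \<longleftrightarrow> [x - y = i] (mod m) \<or> [x - y = - i] (mod m)"
begin

lemma mod_in_verts: "x mod m \<in> verts G" "x mod m + m \<in> verts G"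
proof -
  have "0 \<le> x mod m" "x mod m < m" using m by simp_all
  then show "x mod m \<in> verts G" "x mod m + m \<in> verts G"
    unfolding verts atLeastLessThan_iff using m by linarith+
qed

lemma pair_cases:
  assumes "x \<in> verts G"
  shows "x = x mod m \<or> x = x mod m + m"
proof (cases "x < m")
  case True
  then show ?thesis using assms by (simp add: verts)
next
  case False
  then have "(x - m) mod m = x - m"
    using assms by (intro mod_pos_pos_trivial) (auto simp: verts)
  then have "x mod m = x - m" by (simp only: mod_diff_right_eq minus_mod_self2)
  then show ?thesis by simp
qed

text \<open>The neighbours of \<open>x\<close> are the vertices \<open>x \<plusminus> i\<close> modulo \<open>m\<close>. If \<open>x\<close> and \<open>y\<close> have the same
  neighbours without being congruent, then \<open>x + i\<close> must be \<open>y - i\<close> and \<open>x - i\<close> must be \<open>y + i\<close>.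
  Subtracting gives \<open>4i = 0\<close> modulo \<open>m\<close>, which is impossible for a unit \<open>i\<close> as \<open>m\<close> is neither 1, 2
  nor 4.\<close>

lemma same_open_nbhd_iff:
  assumes "x \<in> verts G" "y \<in> verts G"
  shows "open_nbhd G x = open_nbhd G y \<longleftrightarrow> [x = y] (mod m)"
proof
  assume eq: "open_nbhd G x = open_nbhd G y"
  have nbr: "[z - y = i] (mod m) \<or> [z - y = - i] (mod m)"
    if "[z - x = i] (mod m) \<or> [z - x = - i] (mod m)" for z
  proof -
    have zz: "[z mod m - w = k] (mod m) \<longleftrightarrow> [z - w = k] (mod m)" for w k
      by (simp add: cong_def mod_diff_left_eq)
    have "z mod m \<in> open_nbhd G x"
      using that mod_in_verts(1)[of z] assms by (simp add: open_nbhd_def adj_iff zz)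
    then have "adj G (z mod m) y"
      unfolding eq by (simp add: open_nbhd_def)
    then show ?thesis
      using assms mod_in_verts(1)[of z] by (simp add: adj_iff zz)
  qed
  show "[x = y] (mod m)"
  proof (rule ccontr)
    assume ne: "\<not> [x = y] (mod m)"
    have "[x + i - y = i] (mod m) \<or> [x + i - y = - i] (mod m)"
      by (rule nbr) simp
    then have "m dvd x - y \<or> m dvd x - y + 2 * i"
      by (simp add: cong_iff_dvd_diff algebra_simps)
    moreover have "[x - i - y = i] (mod m) \<or> [x - i - y = - i] (mod m)"
      by (rule nbr) simp
    then have "m dvd x - y \<or> m dvd x - y - 2 * i"
      by (auto simp: cong_iff_dvd_diff algebra_simps)
    ultimately have "m dvd (x - y + 2 * i) - (x - y - 2 * i)"
      using ne dvd_diff unfolding cong_iff_dvd_diff by blast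
    then have "m dvd 4 * i" by simp
    then have "m dvd 4" using coprime by (simp add: coprime_commute coprime_dvd_mult_left_iff)
    moreover from this have "m \<le> 4" by (simp add: zdvd_imp_le)
    ultimately show False using m by (cases "m = 3") auto
  qed
next
  assume "[x = y] (mod m)"
  then have "[z - x = k] (mod m) \<longleftrightarrow> [z - y = k] (mod m)" for z k
    by (simp add: cong_def) (metis mod_diff_right_eq)
  then show "open_nbhd G x = open_nbhd G y"
    using assms by (auto simp: open_nbhd_def adj_iff)
qed

lemma twins_cong:
  assumes "x \<in> verts G" "y \<in> verts G" "[x = y] (mod m)" "x \<noteq> y"
  shows "twins G x y"
  using assms same_open_nbhd_iff by (auto simp: twins_def)

lemma twins_pair:
  assumes "0 \<le> r" "r < m"
  shows "twins G r (r + m)"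
  using assms by (intro twins_cong) (auto simp: verts cong_def)

lemma automorphism_cong_iff:
  assumes "automorphism G f" "x \<in> verts G" "y \<in> verts G"
  shows "[f x = f y] (mod m) \<longleftrightarrow> [x = y] (mod m)"
  using automorphism_same_open_nbhd_iff[OF assms] assms same_open_nbhd_iff automorphism_in_verts
  by metis

text \<open>The pairs are twins, so each of them needs a representative. An automorphism that fixes one
  vertex of each pair preserves the pairs, hence fixes the other vertices, too.\<close>

lemma Det: "Det G = nat m"
proof (rule Det_eqI)
  show "finite {0..<m}" "card {0..<m} = nat m" by simp_all
  have "f = id" if f: "automorphism G f" and fx: "\<forall>w\<in>{0..<m}. f w = w" for f
  proof (rule automorphism_eqI[OF f])
    fix x assume x: "x \<in> verts G"
    have inj: "inj f" using f by (auto simp: automorphism_def permutes_inj)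
    have mm: "f (x mod m) = x mod m" using fx m by simp
    have "[f x = f (x mod m)] (mod m)"
      using automorphism_cong_iff[OF f x mod_in_verts(1)[of x]] by (simp add: cong_def)
    then have same: "f x mod m = x mod m" using mm by (simp add: cong_def)
    have fV: "f x \<in> verts G" using f x by (simp add: automorphism_in_verts)
    show "f x = x"
    proof (cases "f x = x mod m")
      case True
      then show ?thesis using mm inj by (metis injD)
    next
      case False
      then have "f x = x mod m + m" using pair_cases[OF fV] same by simp
      moreover from this have "x \<noteq> x mod m" using mm m by auto
      ultimately show ?thesis using pair_cases[OF x] by simp
    qed
  qed
  then show "determining_set G {0..<m}"
    using m by (auto simp: determining_set_def verts)
next
  fix W assume W: "finite W" "determining_set G W"
  have "r \<in> (\<lambda>x. x mod m) ` W" if "r \<in> {0..<m}" for r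
    using determining_set_twins[OF simple W(2) twins_pair[of r]] that
    by (auto simp: image_iff intro: bexI[of _ r] bexI[of _ "r + m"])
  then have "{0..<m} \<subseteq> (\<lambda>x. x mod m) ` W" by blast
  then have "card {0..<m} \<le> card W"
    using surj_card_le W(1) by blast
  then show "nat m \<le> card W" by simp
qed

text \<open>An automorphism of a cycle that fixes two consecutive vertices is the identity. In the step
  of the induction, the class of \<open>(k + 2) i\<close> must go to one of the two neighbours of the fixed class
  of \<open>(k + 1) i\<close>, and the other neighbour is already taken by the class of \<open>k i\<close>.\<close>

lemma automorphism_fixes_classes:
  assumes f: "automorphism G f"
    and f0: "\<And>x. x \<in> verts G \<Longrightarrow> [x = 0] (mod m) \<Longrightarrow> [f x = x] (mod m)"
    and f1: "\<And>x. x \<in> verts G \<Longrightarrow> [x = i] (mod m) \<Longrightarrow> [f x = x] (mod m)"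
    and x: "x \<in> verts G"
  shows "[f x = x] (mod m)"
proof -
  have step: "(\<forall>x\<in>verts G. [x = int k * i] (mod m) \<longrightarrow> [f x = x] (mod m)) \<and>
      (\<forall>x\<in>verts G. [x = int (Suc k) * i] (mod m) \<longrightarrow> [f x = x] (mod m))" for k
  proof (induction k)
    case 0
    then show ?case using f0 f1 by simp
  next
    case (Suc k)
    have "[f x = x] (mod m)"
      if x: "x \<in> verts G" and xk: "[x = int (Suc (Suc k)) * i] (mod m)" for x
    proof -
      define y z where "y = (int (Suc k) * i) mod m" and "z = (int k * i) mod m"
      have V: "y \<in> verts G" "z \<in> verts G"
        using mod_in_verts(1) by (auto simp: y_def z_def)
      have y: "[y = int (Suc k) * i] (mod m)" and z: "[z = int k * i] (mod m)"
        by (simp_all add: y_def z_def cong_def)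
      have fy: "[f y = y] (mod m)" and fz: "[f z = z] (mod m)"
        using Suc V y z by blast+
      have "[x - y = i] (mod m)"
        using cong_diff[OF xk y] by (simp add: algebra_simps)
      then have "adj G (f x) (f y)"
        using f x V by (simp add: automorphism_def adj_iff)
      then have "[f x - f y = i] (mod m) \<or> [f x - f y = - i] (mod m)"
        using f x V adj_iff by (simp add: automorphism_in_verts)
      then show ?thesis
      proof
        assume "[f x - f y = i] (mod m)"
        from cong_add[OF this cong_trans[OF fy y]] have "[f x = int (Suc (Suc k)) * i] (mod m)"
          by (simp add: algebra_simps)
        then show ?thesis using xk by (metis cong_trans cong_sym)
      next
        assume "[f x - f y = - i] (mod m)"
        from cong_add[OF this cong_trans[OF fy y]] have "[f x = int k * i] (mod m)"
          by (simp add: algebra_simps)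
        then have "[f x = f z] (mod m)" using z fz by (metis cong_trans cong_sym)
        then have "[x = z] (mod m)" using automorphism_cong_iff f x V by blast
        then show ?thesis using \<open>[f x = f z] (mod m)\<close> fz by (metis cong_trans cong_sym)
      qed
    qed
    then show ?case using Suc by blast
  qed
  \<comment> \<open>Division by the unit \<open>i\<close> finds the position of \<open>x\<close> on the cycle.\<close>
  obtain u where u: "[i * u = 1] (mod m)"
    using cong_solve_coprime_int[OF coprime] by blast
  define k where "k = nat ((x * u) mod m)"
  have "int k = (x * u) mod m" using m by (simp add: k_def)
  then have "[int k * i = x * u * i] (mod m)" by (simp add: cong_def mod_mult_left_eq)
  moreover have "[x * u * i = x] (mod m)"
    using cong_scalar_left[OF u, of x] by (simp add: ac_simps)
  ultimately have "[x = int k * i] (mod m)" by (metis cong_trans cong_sym)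
  then show ?thesis using step x by blast
qed

lemma eq_of_cong_color:
  assumes c: "\<And>r. 0 \<le> r \<Longrightarrow> r < m \<Longrightarrow> c r \<noteq> c (r + m)"
    and "x \<in> verts G" "y \<in> verts G" "[x = y] (mod m)" "c x = c y"
  shows "x = y"
proof -
  have "c (x mod m) \<noteq> c (x mod m + m)" using c m by simp
  then show ?thesis
    using pair_cases[of x] pair_cases[of y] assms(2-) unfolding cong_def by metis
qed

text \<open>The two vertices of a pair get different colours from a palette, which is \<open>{0, 1}\<close> for the
  pair of 0, \<open>{0, 2}\<close> for the pair of its neighbour \<open>i\<close> and \<open>{1, 2}\<close> for all other pairs. A colour
  preserving automorphism maps a pair to a pair with the same palette. It therefore fixes the first
  two pairs, hence all pairs, and the colours then fix both vertices of each pair.\<close>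

lemma ex_distinguishing_3_coloring: "\<exists>c. distinguishing_coloring G 3 c"
proof -
  \<comment> \<open>The colour depends on the residue and on which of the two copies the vertex is.\<close>
  define h :: "int \<Rightarrow> bool \<Rightarrow> nat" where "h r low =
    (if r = 0 then if low then 0 else 1
     else if r = i mod m then if low then 0 else 2
     else if low then 1 else 2)" for r low
  define c where "c x = h (x mod m) (x < m)" for x
  have c_pair: "c r \<noteq> c (r + m)" if "0 \<le> r" "r < m" for r
    using that by (simp add: c_def h_def)
  have i0: "i mod m \<noteq> 0"
  proof
    assume "i mod m = 0"
    then have "m dvd 1" using coprime by (simp add: dvd_eq_mod_eq_0[symmetric] coprime_def)
    then show False using m by simp
  qed
  have class0: "r = 0" if "h r low = 0" "h r low' = 1" for r low low'
    using that by (auto simp: h_def split: if_splits)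
  have classi: "r = i mod m" if "h r low = 0" "h r low' = 2" for r low low'
    using that by (auto simp: h_def split: if_splits)
  have "f = id" if f: "automorphism G f" and fc: "\<forall>v\<in>verts G. c (f v) = c v" for f
  proof (rule automorphism_eqI[OF f])
    have same: "f x mod m = f y mod m" if "x \<in> verts G" "y \<in> verts G" "x mod m = y mod m" for x y
      using automorphism_cong_iff[OF f that(1,2)] that(3) by (simp add: cong_def)
    have f0: "[f x = x] (mod m)" if "x \<in> verts G" "[x = 0] (mod m)" for x
    proof -
      have V: "0 \<in> verts G" "m \<in> verts G" using m by (auto simp: verts)
      have "c 0 = 0" "c m = 1" using m by (simp_all add: c_def h_def)
      then have "c (f 0) = 0" "c (f m) = 1" using fc V by simp_all
      moreover have "f 0 mod m = f m mod m" using same[OF V] by simp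
      ultimately have "f 0 mod m = 0" unfolding c_def by (metis class0)
      then show ?thesis using same[OF that(1) V(1)] that(2) by (simp add: cong_def)
    qed
    have f1: "[f x = x] (mod m)" if "x \<in> verts G" "[x = i] (mod m)" for x
    proof -
      let ?r = "i mod m"
      have "?r < m" "0 \<le> ?r" using m by simp_all
      then have "c ?r = 0" "c (?r + m) = 2"
        using i0 by (simp_all add: c_def h_def)
      then have "c (f ?r) = 0" "c (f (?r + m)) = 2"
        using fc mod_in_verts[of i] by simp_all
      moreover have "f ?r mod m = f (?r + m) mod m" using same[OF mod_in_verts[of i]] by simp
      ultimately have "f ?r mod m = ?r" unfolding c_def by (metis classi)
      then show ?thesis using same[OF that(1) mod_in_verts(1)[of i]] that(2) by (simp add: cong_def)
    qed
    fix x assume x: "x \<in> verts G"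
    have "[f x = x] (mod m)" using automorphism_fixes_classes[OF f f0 f1 x] .
    then show "f x = x"
      using eq_of_cong_color[of c, OF c_pair, of "f x" x] x fc automorphism_in_verts[OF f] by simp
  qed
  moreover have "c \<in> verts G \<rightarrow> {..<3}" by (auto simp: c_def h_def)
  ultimately show ?thesis by (auto simp: distinguishing_coloring_iff)
qed

text \<open>With at most two colours, every pair uses both of them. Mapping \<open>x\<close> to the vertex of the same
  colour in the pair of \<open>x + 1\<close> preserves the colours, and it is an automorphism because adjacency
  depends only on differences modulo \<open>m\<close>.\<close>

lemma distinguishing_coloring_ge_3:
  assumes c: "distinguishing_coloring G d c"
  shows "3 \<le> d"
proof (rule ccontr)
  assume "\<not> 3 \<le> d"
  then have d: "d \<le> 2" by simp
  have cd: "c x < d" if "x \<in> verts G" for x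
    using c that by (auto simp: distinguishing_coloring_def)
  have c_pair: "c r \<noteq> c (r + m)" if "0 \<le> r" "r < m" for r
    using distinguishing_coloring_twins[OF simple c twins_pair] that .
  note eqI = eq_of_cong_color[of c, OF c_pair]
  have ex: "\<exists>y\<in>verts G. [y = x + 1] (mod m) \<and> c y = c x" if x: "x \<in> verts G" for x
  proof -
    let ?r = "(x + 1) mod m"
    have "c ?r \<noteq> c (?r + m)" using c_pair m by simp
    then have "c ?r = c x \<or> c (?r + m) = c x"
      using cd[OF x] cd[OF mod_in_verts(1)[of "x + 1"]] cd[OF mod_in_verts(2)[of "x + 1"]] d by linarith
    moreover have "[?r = x + 1] (mod m)" "[?r + m = x + 1] (mod m)"
      by (simp_all add: cong_def)
    ultimately show ?thesis using mod_in_verts[of "x + 1"] by blast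
  qed
  then obtain g where g: "\<And>x. x \<in> verts G \<Longrightarrow> g x \<in> verts G"
    "\<And>x. x \<in> verts G \<Longrightarrow> [g x = x + 1] (mod m)" "\<And>x. x \<in> verts G \<Longrightarrow> c (g x) = c x"
    by metis
  define f where "f x = (if x \<in> verts G then g x else x)" for x
  have "inj_on g (verts G)"
  proof (rule inj_onI)
    fix x y assume xy: "x \<in> verts G" "y \<in> verts G" "g x = g y"
    then have "[x + 1 = y + 1] (mod m)" using g(2) by (metis cong_trans cong_sym)
    then have "[x = y] (mod m)" by (simp add: cong_add_rcancel)
    moreover have "c x = c y" using xy g(3) by metis
    ultimately show "x = y" using eqI xy by blast
  qed
  then have "inj_on f (verts G)" by (simp add: f_def inj_on_def)
  moreover have "finite (verts G)" by (simp add: verts)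
  moreover have "f ` verts G \<subseteq> verts G" using g(1) by (auto simp: f_def)
  ultimately have "bij_betw f (verts G) (verts G)"
    by (simp add: bij_betw_def endo_inj_surj)
  then have "f permutes verts G" by (rule bij_imp_permutes) (simp add: f_def)
  moreover have "adj G (f a) (f b) \<longleftrightarrow> adj G a b" if ab: "a \<in> verts G" "b \<in> verts G" for a b
  proof -
    have "[g a - g b = a - b] (mod m)"
      using cong_diff[OF g(2)[OF ab(1)] g(2)[OF ab(2)]] by simp
    then show ?thesis using ab g(1) by (simp add: f_def adj_iff cong_def)
  qed
  ultimately have "automorphism G f" by (simp add: automorphism_def)
  then have "f = id"
    using c g(3) by (simp add: distinguishing_coloring_iff f_def)
  have "0 \<in> verts G" using m by (simp add: verts)
  then have "[f 0 = 1] (mod m)" using g(2)[of 0] by (simp add: f_def)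
  then show False using \<open>f = id\<close> m by (simp add: cong_def)
qed

lemma Dist: "Dist G = 3"
  using ex_distinguishing_3_coloring distinguishing_coloring_ge_3 Dist_eqI by metis

end

section \<open>The circulant graphs\<close>

text \<open>Modulo \<open>m = i + j\<close> the residues \<open>i\<close> and \<open>- j\<close> agree, and modulo \<open>2m\<close> they are the two different
  lifts of this residue. So differences \<open>i\<close> or \<open>- j\<close> modulo \<open>2m\<close> amount to the difference \<open>i\<close> modulo
  \<open>m\<close>, and likewise with the opposite signs.\<close>

lemma circulant_doubled_cycle:
  fixes i j :: int
  assumes "0 < i" "i < j" "gcd i j = 1" "3 \<le> i + j" "i + j \<noteq> 4"
  shows "doubled_cycle (circulant (2 * (i + j)) i j) (i + j) i"
proof
  let ?m = "i + j" and ?G = "circulant (2 * (i + j)) i j"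
  show "simple_graph ?G" by (rule simple_graph_circulant)
  show "verts ?G = {0..<2 * ?m}" by (auto simp: verts_circulant)
  show "3 \<le> ?m" "?m \<noteq> 4" by fact+
  show "coprime i ?m" using assms(3) by (simp add: coprime_iff_gcd_eq_1)
  have lift: "[d = e] (mod ?m) \<longleftrightarrow> [d = e] (mod (2 * ?m)) \<or> [d = e - ?m] (mod (2 * ?m))"
    (is "?L \<longleftrightarrow> ?R") for d e
  proof
    assume ?L
    then obtain k where k: "d - e = ?m * k" by (auto simp: cong_iff_dvd_diff)
    show ?R
    proof (cases "even k")
      case True
      then obtain l where "k = 2 * l" by blast
      then have "d - e = (2 * ?m) * l" using k by simp
      then show ?thesis unfolding cong_iff_dvd_diff by simp
    next
      case False
      then obtain l where "k = 2 * l + 1" by (rule oddE)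
      then have "d - (e - ?m) = (2 * ?m) * (l + 1)" using k by (simp add: algebra_simps)
      then show ?thesis unfolding cong_iff_dvd_diff by (metis dvd_triv_left)
    qed
  next
    assume ?R
    then have "[d = e] (mod ?m) \<or> [d = e - ?m] (mod ?m)"
      by (metis cong_modulus_mult cong_modulus_mult mult.commute)
    then show ?L by (auto simp: cong_def mod_diff_right_eq)
  qed
  fix x y assume xy: "x \<in> verts ?G" "y \<in> verts ?G"
  have "\<not> [0 = i] (mod ?m)" "\<not> [0 = - i] (mod ?m)"
    using assms(1,2) by (auto simp: cong_iff_dvd_diff dest: zdvd_imp_le)
  moreover have "[x - y = i] (mod ?m) \<longleftrightarrow> [x - y = i] (mod (2 * ?m)) \<or> [x - y = - j] (mod (2 * ?m))"
    using lift[of "x - y" i] by simp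
  moreover have "[x - y = - i] (mod ?m) \<longleftrightarrow> [x - y = - i] (mod (2 * ?m)) \<or> [x - y = j] (mod (2 * ?m))"
  proof -
    have "- i - ?m = j - 2 * ?m" by simp
    then have "(- i - ?m) mod (2 * ?m) = j mod (2 * ?m)" by (metis minus_mod_self2)
    then show ?thesis using lift[of "x - y" "- i"] by (simp only: cong_def)
  qed
  ultimately show "adj ?G x y \<longleftrightarrow> [x - y = i] (mod ?m) \<or> [x - y = - i] (mod ?m)"
    unfolding adj_circulant_iff[OF xy] by (cases "x = y") auto
qed

text \<open>The differences \<open>\<plusminus> 1\<close> and \<open>\<plusminus> 3\<close> are all the odd residues, both modulo 6 and modulo 8.\<close>

lemma circulant_balanced_complete_bipartite:
  assumes "n = 6 \<and> p = 3 \<or> n = 8 \<and> p = 4"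
  shows "balanced_complete_bipartite (circulant n 1 3)
    ({0..n - 1} \<inter> Collect even) ({0..n - 1} \<inter> Collect odd) p"
proof
  let ?A = "({0..n - 1} \<inter> Collect even)" and ?B = "({0..n - 1} \<inter> Collect odd)"
  show "simple_graph (circulant n 1 3)" by (rule simple_graph_circulant)
  show V: "verts (circulant n 1 3) = ?A \<union> ?B" by (auto simp: verts_circulant)
  have "{0..5::int} = {0, 1, 2, 3, 4, 5}" "{0..7::int} = {0, 1, 2, 3, 4, 5, 6, 7}" by auto
  then show "card ?A = p" "card ?B = p" using assms by auto
  show "2 \<le> p" using assms by auto
  fix a b assume ab: "a \<in> ?A \<union> ?B" "b \<in> ?A \<union> ?B"
  have "[d = 1] (mod n) \<or> [d = - 1] (mod n) \<or> [d = 3] (mod n) \<or> [d = - 3] (mod n) \<longleftrightarrow> odd d" for d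
    using assms unfolding cong_iff_dvd_diff by (elim disjE conjE; simp only:; presburger)
  then show "adj (circulant n 1 3) a b \<longleftrightarrow> (a \<in> ?A) \<noteq> (b \<in> ?A)"
    using ab V adj_circulant_iff[of a n 1 3 b] by auto
qed auto

text \<open>The differences \<open>\<plusminus> 1\<close> and \<open>\<plusminus> 2\<close> are all the nonzero residues, both modulo 4 and modulo 5.\<close>

lemma Det_Dist_circulant_1_2:
  assumes "n = 4 \<or> n = 5"
  shows "int (Det (circulant n 1 2)) = n - 1" "int (Dist (circulant n 1 2)) = n"
proof -
  have V: "verts (circulant n 1 2) = {0..n - 1}" by (rule verts_circulant)
  have adj: "adj (circulant n 1 2) a b"
    if ab: "a \<in> verts (circulant n 1 2)" "b \<in> verts (circulant n 1 2)" "a \<noteq> b" for a b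
  proof -
    have "\<not> [a = b] (mod n)"
      using ab cong_less_imp_eq_int[of a n b] by (auto simp: V)
    moreover have "[d = 1] (mod n) \<or> [d = - 1] (mod n) \<or> [d = 2] (mod n) \<or> [d = - 2] (mod n)
        \<longleftrightarrow> \<not> n dvd d" for d
      using assms unfolding cong_iff_dvd_diff by (elim disjE; simp only:; presburger)
    ultimately show ?thesis
      using adj_circulant_iff[OF ab(1,2)] ab(3) by (simp add: cong_iff_dvd_diff)
  qed
  have fin: "finite (verts (circulant n 1 2))" "verts (circulant n 1 2) \<noteq> {}"
    using assms by (auto simp: V)
  show "int (Det (circulant n 1 2)) = n - 1" "int (Dist (circulant n 1 2)) = n"
    using Det_Dist_complete[OF simple_graph_circulant fin adj] assms by (auto simp: V)
qed

theorem theorem5: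
  fixes n i j :: int
  assumes "0 < i" and "i < j" and "2 * j \<le> n"
    and "gcd n (gcd i j) = 1"
    and "i = 1 \<or> (i \<notin> Units (residue_ring n) \<and> j \<notin> Units (residue_ring n))"
    and "has_twins (circulant n i j)"
  shows "(n \<in> {4, 5} \<longrightarrow>
           int (Det (circulant n i j)) = n - 1 \<and> int (Dist (circulant n i j)) = n) \<and>
         ((n, i, j) = (6, 1, 3) \<longrightarrow>
           Det (circulant n i j) = 4 \<and> Dist (circulant n i j) = 4) \<and>
         (n \<ge> 6 \<and> 2 * (i + j) = n \<longrightarrow>
           (if (n, i, j) = (8, 1, 3)
            then Det (circulant n i j) = 6 \<and> Dist (circulant n i j) = 5
            else 2 * int (Det (circulant n i j)) = n \<and> Dist (circulant n i j) = 3))"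
proof (intro conjI impI)
  assume n: "n \<in> {4, 5}"
  then have "i = 1" "j = 2" using assms(1-3) by auto
  then show "int (Det (circulant n i j)) = n - 1" "int (Dist (circulant n i j)) = n"
    using Det_Dist_circulant_1_2 n by auto
next
  assume nij: "(n, i, j) = (6, 1, 3)"
  then interpret balanced_complete_bipartite "circulant n i j"
    "{0..n - 1} \<inter> Collect even" "{0..n - 1} \<inter> Collect odd" 3
    using circulant_balanced_complete_bipartite[of 6 3] by simp
  show "Det (circulant n i j) = 4" "Dist (circulant n i j) = 4"
    using Det Dist by simp_all
next
  assume n: "n \<ge> 6 \<and> 2 * (i + j) = n"
  show "if (n, i, j) = (8, 1, 3)
    then Det (circulant n i j) = 6 \<and> Dist (circulant n i j) = 5
    else 2 * int (Det (circulant n i j)) = n \<and> Dist (circulant n i j) = 3"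
  proof (cases "(n, i, j) = (8, 1, 3)")
    case True
    then interpret balanced_complete_bipartite "circulant n i j"
      "{0..n - 1} \<inter> Collect even" "{0..n - 1} \<inter> Collect odd" 4
      using circulant_balanced_complete_bipartite[of 8 4] by simp
    show ?thesis using True Det Dist by simp
  next
    case False
    \<comment> \<open>As \<open>n = 2 (i + j)\<close>, every common divisor of \<open>i\<close> and \<open>j\<close> divides \<open>n\<close>.\<close>
    have "gcd i j dvd n" using n by auto
    then have "gcd i j dvd gcd n (gcd i j)" by simp
    then have "gcd i j = 1" using assms(4) by simp
    moreover have "i + j \<noteq> 4" using False n assms(1,2) by auto
    ultimately interpret doubled_cycle "circulant n i j" "i + j" i
      using circulant_doubled_cycle[of i j] assms(1,2) n by auto
    show ?thesis using Det Dist n assms(1,2) unfolding if_not_P[OF False] by simp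
  qed
qed

end
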